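(* Let $r\ge 2$ and let $\lambda=\alpha_1+\alpha_2+\cdots+\alpha_r$, the sum of the simple roots, which is a fundamental weight of $\mathfrak{so}_{2r+1}(\mathbb C)$. Then $|\mathcal A(\lambda,0)|=F_{r+1}$, where $F_{r+1}$ denotes the $(r+1)$-th Fibonacci number.
   Context: Let $\varepsilon_1,\ldots,\varepsilon_r$ be the standard basis of $\mathbb R^r$. The simple roots of $\mathfrak{so}_{2r+1}(\mathbb C)$ are $\alpha_i=\varepsilon_i-\varepsilon_{i+1}$ for $1\le i\le r-1$ and $\alpha_r=\varepsilon_r$; the positive roots are $\Phi^+=\{\varepsilon_i\pm\varepsilon_j:1\le i<j\le r\}\cup\{\varepsilon_i:1\le i\le r\}$. Set $\rho=\frac12\sum_{\alpha\in\Phi^+}\alpha$. The Weyl group $W$ is generated by the simple reflections $s_i$ in the hyperplanes orthogonal to $\alpha_i$, $1\le i\le r$. Kostant's partition function $\wp(\xi)$ is the number of ways to write $\xi$ as a nonnegative integral linear combination of positive roots (so $\wp(0)=1$). For weights $\lambda,\mu$, the Weyl alternation set is $\mathcal A(\lambda,\mu)=\{\sigma\in W:\wp(\sigma(\lambda+\rho)-(\mu+\rho))>0\}$. Fibonacci numbers: $F_1=F_2=1$, $F_n=F_{n-1}+F_{n-2}$. *)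

theory Defs
  imports
    Complex_Main
    "HOL-Library.Function_Algebras"
    "HOL-Algebra.Bij"
    "HOL-Algebra.Generated_Groups"
    "HOL-Number_Theory.Fib"
begin

text \<open>
  Since the rank r is a natural number, a vector of \<open>\<real>\<^sup>r\<close> is a function from \<open>nat\<close> to
  \<open>real\<close> that vanishes outside the index set \<open>{1..r}\<close>; addition, subtraction, zero and finite
  sums of vectors are the pointwise ones.
\<close>

type_synonym weight_vec = "nat \<Rightarrow> real"

definition Rvec :: "nat \<Rightarrow> weight_vec set" where
  "Rvec r = {v. \<forall>k. k \<notin> {1..r} \<longrightarrow> v k = 0}"

definition scale :: "real \<Rightarrow> weight_vec \<Rightarrow> weight_vec" where
  "scale c v = (\<lambda>k. c * v k)"

definition dotprod :: "nat \<Rightarrow> weight_vec \<Rightarrow> weight_vec \<Rightarrow> real" where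
  "dotprod r u v = (\<Sum>k = 1..r. u k * v k)"

definition eps :: "nat \<Rightarrow> weight_vec" where
  "eps i = (\<lambda>k. if k = i then 1 else 0)"

definition simple_root :: "nat \<Rightarrow> nat \<Rightarrow> weight_vec" where
  "simple_root r i = (if i < r then eps i - eps (i + 1) else eps r)"

definition positive_roots :: "nat \<Rightarrow> weight_vec set" where
  "positive_roots r =
     {eps i - eps j | i j. 1 \<le> i \<and> i < j \<and> j \<le> r} \<union>
     {eps i + eps j | i j. 1 \<le> i \<and> i < j \<and> j \<le> r} \<union>
     {eps i | i. 1 \<le> i \<and> i \<le> r}"

definition rho :: "nat \<Rightarrow> weight_vec" where
  "rho r = scale (1 / 2) (\<Sum>\<alpha>\<in>positive_roots r. \<alpha>)"

text \<open>
  \<open>coroot_pairing r \<alpha> v\<close> is \<open>2(v,\<alpha>)/(\<alpha>,\<alpha>)\<close>; the fundamental weights are the basis dual to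
  the simple coroots.
\<close>

definition coroot_pairing :: "nat \<Rightarrow> weight_vec \<Rightarrow> weight_vec \<Rightarrow> real" where
  "coroot_pairing r \<alpha> v = 2 * dotprod r v \<alpha> / dotprod r \<alpha> \<alpha>"

definition fundamental_weight :: "nat \<Rightarrow> weight_vec \<Rightarrow> bool" where
  "fundamental_weight r \<omega> \<longleftrightarrow> \<omega> \<in> Rvec r \<and>
     (\<exists>i\<in>{1..r}. \<forall>j\<in>{1..r}.
        coroot_pairing r (simple_root r j) \<omega> = (if j = i then 1 else 0))"

text \<open>
  The Weyl group is a subgroup of \<open>BijGroup (Rvec r)\<close>. The elements of that group are extensional
  functions (\<open>undefined\<close> outside \<open>Rvec r\<close>), hence the restriction in \<open>reflection\<close>; distinct
  elements of the group are distinct maps on \<open>Rvec r\<close>.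
\<close>

definition reflection :: "nat \<Rightarrow> weight_vec \<Rightarrow> weight_vec \<Rightarrow> weight_vec" where
  "reflection r \<alpha> = (\<lambda>v\<in>Rvec r. v - scale (coroot_pairing r \<alpha> v) \<alpha>)"

definition weyl_group :: "nat \<Rightarrow> (weight_vec \<Rightarrow> weight_vec) set" where
  "weyl_group r = generate (BijGroup (Rvec r)) {reflection r (simple_root r i) | i. i \<in> {1..r}}"

text \<open>
  A way of writing \<open>\<xi>\<close> is a family \<open>m\<close> of multiplicities of the positive roots; requiring \<open>m\<close> to
  vanish elsewhere makes different functions different ways. The set counted is always finite, by
  \<open>finite_kostant_partitions\<close> below.
\<close>

definition kostant_partitions :: "nat \<Rightarrow> weight_vec \<Rightarrow> (weight_vec \<Rightarrow> nat) set" where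
  "kostant_partitions r \<xi> =
     {m. (\<forall>\<alpha>. \<alpha> \<notin> positive_roots r \<longrightarrow> m \<alpha> = 0) \<and>
         \<xi> = (\<Sum>\<alpha>\<in>positive_roots r. scale (real (m \<alpha>)) \<alpha>)}"

definition kostant :: "nat \<Rightarrow> weight_vec \<Rightarrow> nat" where
  "kostant r \<xi> = card (kostant_partitions r \<xi>)"

definition weyl_alternation_set :: "nat \<Rightarrow> weight_vec \<Rightarrow> weight_vec \<Rightarrow> (weight_vec \<Rightarrow> weight_vec) set" where
  "weyl_alternation_set r lam mu =
     {\<sigma> \<in> weyl_group r. kostant r (\<sigma> (lam + rho r) - (mu + rho r)) > 0}"

lemma finite_positive_roots: "finite (positive_roots r)"
proof -
  have "positive_roots r \<subseteq>
     (\<lambda>(i, j). eps i - eps j) ` ({1..r} \<times> {1..r}) \<union>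
     (\<lambda>(i, j). eps i + eps j) ` ({1..r} \<times> {1..r}) \<union> eps ` {1..r}"
  proof
    fix x assume "x \<in> positive_roots r"
    then consider i j where "x = eps i - eps j" "i \<in> {1..r}" "j \<in> {1..r}"
      | i j where "x = eps i + eps j" "i \<in> {1..r}" "j \<in> {1..r}"
      | i where "x = eps i" "i \<in> {1..r}"
      unfolding positive_roots_def by fastforce
    then show "x \<in> (\<lambda>(i, j). eps i - eps j) ` ({1..r} \<times> {1..r}) \<union>
      (\<lambda>(i, j). eps i + eps j) ` ({1..r} \<times> {1..r}) \<union> eps ` {1..r}"
      by cases (auto simp del: atLeastAtMost_iff)
  qed
  then show ?thesis by (rule finite_subset) auto
qed

lemma sum_fun_apply: "(\<Sum>a\<in>A. f a) k = (\<Sum>a\<in>A. f a k)"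
  for f :: "'a \<Rightarrow> 'b \<Rightarrow> real"
  by (induction A rule: infinite_finite_induct) auto

lemma positive_root_height:
  assumes "\<alpha> \<in> positive_roots r"
  shows "(\<Sum>k = 1..r. (real r + 1 - real k) * \<alpha> k) \<ge> 1"
proof -
  have e: "(\<Sum>k = 1..r. (real r + 1 - real k) * eps i k) = real r + 1 - real i"
    if "1 \<le> i" "i \<le> r" for i
    using that by (simp add: eps_def if_distrib[where f = "\<lambda>x. _ * x"] sum.delta cong: if_cong)
  show ?thesis
    using assms unfolding positive_roots_def
    by (auto simp: e[simplified] distrib_left right_diff_distrib sum.distrib sum_subtractf)
qed

lemma finite_kostant_partitions: "finite (kostant_partitions r \<xi>)"
proof -
  define h where "h v = (\<Sum>k = 1..r. (real r + 1 - real k) * v k)" for v :: weight_vec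
  define N where "N = nat \<lceil>h \<xi>\<rceil>"
  have "m \<alpha> \<le> N" if m: "m \<in> kostant_partitions r \<xi>" and \<alpha>: "\<alpha> \<in> positive_roots r" for m \<alpha>
  proof -
    have "h \<xi> = (\<Sum>\<beta>\<in>positive_roots r. real (m \<beta>) * h \<beta>)"
    proof -
      have "h \<xi> = (\<Sum>k = 1..r. (real r + 1 - real k) *
                     (\<Sum>\<beta>\<in>positive_roots r. real (m \<beta>) * \<beta> k))"
        using m by (simp add: h_def kostant_partitions_def sum_fun_apply scale_def)
      also have "\<dots> = (\<Sum>k = 1..r. \<Sum>\<beta>\<in>positive_roots r.
                     real (m \<beta>) * ((real r + 1 - real k) * \<beta> k))"
        by (simp add: sum_distrib_left mult_ac)
      also have "\<dots> = (\<Sum>\<beta>\<in>positive_roots r. real (m \<beta>) * h \<beta>)"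
        by (subst sum.swap) (simp add: h_def sum_distrib_left)
      finally show ?thesis .
    qed
    moreover have h1: "h \<beta> \<ge> 1" if "\<beta> \<in> positive_roots r" for \<beta>
      using positive_root_height[OF that] by (simp add: h_def)
    moreover have "real (m \<alpha>) * h \<alpha> \<le> (\<Sum>\<beta>\<in>positive_roots r. real (m \<beta>) * h \<beta>)"
    proof (rule member_le_sum[OF \<alpha> _ finite_positive_roots])
      fix \<beta> assume "\<beta> \<in> positive_roots r - {\<alpha>}"
      then have "h \<beta> \<ge> 1" using h1 by auto
      then show "0 \<le> real (m \<beta>) * h \<beta>" by simp
    qed
    moreover have "real (m \<alpha>) * 1 \<le> real (m \<alpha>) * h \<alpha>"
      by (rule mult_left_mono) (use h1[OF \<alpha>] in auto)
    ultimately have "real (m \<alpha>) \<le> h \<xi>" by linarith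
    then show ?thesis unfolding N_def by linarith
  qed
  then have "kostant_partitions r \<xi> \<subseteq>
      {m. \<forall>\<alpha>. (\<alpha> \<in> positive_roots r \<longrightarrow> m \<alpha> \<in> {..N}) \<and> (\<alpha> \<notin> positive_roots r \<longrightarrow> m \<alpha> = 0)}"
    by (auto simp: kostant_partitions_def)
  then show ?thesis
    by (rule finite_subset) (intro finite_set_of_finite_funs finite_positive_roots finite_atMost)
qed

lemma dotprod_simple_root_neq_0:
  assumes "i \<in> {1..r}"
  shows "dotprod r (simple_root r i) (simple_root r i) \<noteq> 0"
proof -
  have "dotprod r (simple_root r i) (simple_root r i) \<ge> (simple_root r i i)\<^sup>2"
    using assms unfolding dotprod_def power2_eq_square
    by (intro member_le_sum) auto
  moreover have "(simple_root r i i)\<^sup>2 = 1"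
    using assms by (auto simp: simple_root_def eps_def)
  ultimately show ?thesis by linarith
qed

lemma reflection_simple_root_in_BijGroup:
  assumes i: "i \<in> {1..r}"
  shows "reflection r (simple_root r i) \<in> carrier (BijGroup (Rvec r))"
proof -
  define \<alpha> where "\<alpha> = simple_root r i"
  define s where "s = reflection r \<alpha>"
  have \<alpha>: "\<alpha> \<in> Rvec r" and n: "dotprod r \<alpha> \<alpha> \<noteq> 0"
    using i dotprod_simple_root_neq_0[OF i]
    by (auto simp: \<alpha>_def simple_root_def eps_def Rvec_def)
  have closed: "s v \<in> Rvec r" if "v \<in> Rvec r" for v
    using that \<alpha> by (auto simp: s_def reflection_def Rvec_def scale_def)
  have inv: "s (s v) = v" if v: "v \<in> Rvec r" for v
  proof -
    have sv: "s v = v - scale (coroot_pairing r \<alpha> v) \<alpha>"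
      using v by (simp add: s_def reflection_def)
    have "dotprod r (s v) \<alpha> = dotprod r v \<alpha> - coroot_pairing r \<alpha> v * dotprod r \<alpha> \<alpha>"
      by (simp add: sv dotprod_def scale_def left_diff_distrib sum_subtractf
            sum_distrib_left mult.assoc)
    then have "coroot_pairing r \<alpha> (s v) = - coroot_pairing r \<alpha> v"
      using n by (simp add: coroot_pairing_def field_simps)
    moreover have "s (s v) = s v - scale (coroot_pairing r \<alpha> (s v)) \<alpha>"
      using closed[OF v] by (simp add: s_def reflection_def)
    ultimately show ?thesis by (auto simp: sv scale_def)
  qed
  have "bij_betw s (Rvec r) (Rvec r)"
    by (rule bij_betw_byWitness[where f' = s]) (use closed inv in auto)
  moreover have "s \<in> extensional (Rvec r)"
    by (simp add: s_def reflection_def)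
  ultimately show ?thesis
    by (simp add: BijGroup_def Bij_def s_def \<alpha>_def)
qed

end

theory Submission
  imports Defs
begin

text \<open>
  Write \<open>a = \<lambda> + \<rho>\<close>, where \<open>\<lambda> = \<alpha>\<^sub>1 + \<dots> + \<alpha>\<^sub>r = \<epsilon>\<^sub>1\<close>. An element \<open>w\<close> of the Weyl group
  lies in the alternation set iff \<open>w a - \<rho>\<close> is a nonnegative integral combination of simple
  roots. Put \<open>w a = a - \<Sum> c\<^sub>i \<alpha>\<^sub>i\<close>, so that \<open>w a - \<rho> = \<Sum> (1 - c\<^sub>i) \<alpha>\<^sub>i\<close>. Then:

  \<^item> \<open>c\<^sub>i\<close> is an integer with \<open>c\<^sub>i \<le> 1\<close>, by membership in the alternation set;
  \<^item> \<open>c\<^sub>i \<ge> 0\<close>, because \<open>a\<close> is dominant and so dominates its whole orbit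
    (\<open>sum_signed_permutation_le\<close>).

  Hence \<open>w a = a - \<Sum>\<^bsub>i\<in>J\<^esub> \<alpha>\<^sub>i\<close> for a set \<open>J\<close>. Since \<open>w\<close> is an isometry, \<open>w a\<close> and \<open>a\<close> have
  the same length. As \<open>2(a,\<alpha>\<^sub>i) = (\<alpha>\<^sub>i,\<alpha>\<^sub>i)\<close> for \<open>i \<ge> 2\<close> and \<open>2(a,\<alpha>\<^sub>1) = 2(\<alpha>\<^sub>1,\<alpha>\<^sub>1)\<close>, expanding
  the squares leaves a sum of nonnegative terms equal to zero, one for \<open>1 \<in> J\<close> and one for each
  pair of neighbours in \<open>J\<close> (\<open>norm_defect\<close>). So \<open>J \<subseteq> {2..r}\<close> has no two consecutive elements.

  Conversely, for such a \<open>J\<close> the reflections \<open>s\<^sub>i\<close> with \<open>i \<in> J\<close> commute, and their product sends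
  \<open>a\<close> to \<open>a - \<Sum>\<^bsub>i\<in>J\<^esub> \<alpha>\<^sub>i\<close> (\<open>sparse_set_realised\<close>). Because \<open>a\<close> is regular, \<open>w\<close> is determined by
  \<open>w a\<close> (\<open>weyl_group_eqI\<close>). The alternation set is thus in bijection with the sets \<open>J\<close>, and these
  are counted by the Fibonacci recursion.
\<close>

section \<open>Sets without consecutive elements\<close>

definition sparse_sets :: "nat \<Rightarrow> nat set set" where
  "sparse_sets n = {J. J \<subseteq> {2..n} \<and> (\<forall>k\<in>J. Suc k \<notin> J)}"

lemma finite_sparse_sets: "finite (sparse_sets n)"
  by (rule finite_subset[of _ "Pow {2..n}"]) (auto simp: sparse_sets_def)

text \<open>
  A sparse subset of \<open>{2..n+2}\<close> either avoids \<open>n+2\<close>, or contains it and then avoids \<open>n+1\<close>.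
\<close>

lemma sparse_sets_Suc_Suc:
  "sparse_sets (Suc (Suc n)) = sparse_sets (Suc n) \<union> insert (Suc (Suc n)) ` sparse_sets n"
proof (intro subset_antisym subsetI)
  fix J assume J: "J \<in> sparse_sets (Suc (Suc n))"
  show "J \<in> sparse_sets (Suc n) \<union> insert (Suc (Suc n)) ` sparse_sets n"
  proof (cases "Suc (Suc n) \<in> J")
    case True
    then have "Suc n \<notin> J" using J by (auto simp: sparse_sets_def)
    then have "J - {Suc (Suc n)} \<subseteq> {2..n}"
      using J by (fastforce simp: sparse_sets_def le_Suc_eq)
    then have "J - {Suc (Suc n)} \<in> sparse_sets n"
      using J by (auto simp: sparse_sets_def)
    moreover have "J = insert (Suc (Suc n)) (J - {Suc (Suc n)})"
      using True by auto
    ultimately show ?thesis by blast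
  next
    case False
    then have "J \<subseteq> {2..Suc n}"
      using J by (fastforce simp: sparse_sets_def le_Suc_eq)
    then show ?thesis using J by (auto simp: sparse_sets_def)
  qed
next
  fix J assume "J \<in> sparse_sets (Suc n) \<union> insert (Suc (Suc n)) ` sparse_sets n"
  then show "J \<in> sparse_sets (Suc (Suc n))"
    by (fastforce simp: sparse_sets_def)
qed

lemma card_sparse_sets: "card (sparse_sets n) = fib (n + 1)"
proof (induction n rule: fib.induct)
  case 1
  have "sparse_sets 0 = {{}}" by (auto simp: sparse_sets_def)
  then show ?case by simp
next
  case 2
  have "sparse_sets (Suc 0) = {{}}" by (auto simp: sparse_sets_def)
  then show ?case by simp
next
  case (3 n)
  have notin: "Suc (Suc n) \<notin> J" if "J \<in> sparse_sets (Suc n) \<union> sparse_sets n" for J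
    using that by (auto simp: sparse_sets_def)
  have "inj_on (insert (Suc (Suc n))) (sparse_sets n)"
    using notin by (intro inj_onI) (metis Un_iff insert_ident)
  moreover have "sparse_sets (Suc n) \<inter> insert (Suc (Suc n)) ` sparse_sets n = {}"
    using notin by blast
  ultimately show ?case
    using 3 by (simp add: sparse_sets_Suc_Suc card_Un_disjoint finite_sparse_sets card_image)
qed

section \<open>Coordinates of simple roots and of the half sum of positive roots\<close>

lemma simple_root_apply:
  assumes "i \<in> {1..r}" "k \<le> r"
  shows "simple_root r i k = of_bool (k = i) - of_bool (k = Suc i)"
  using assms by (auto simp: simple_root_def eps_def)

text \<open>
  The bound \<open>k \<le> r\<close> matters: the last simple root is \<open>\<epsilon>\<^sub>r\<close>, without the term \<open>- \<epsilon>\<^bsub>r+1\<^esub>\<close> that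
  the uniform formula would give at \<open>k = r + 1\<close>.
\<close>

lemma sum_simple_roots_apply:
  assumes "J \<subseteq> {1..r}" "k \<in> {1..r}"
  shows "(\<Sum>i\<in>J. simple_root r i) k = of_bool (k \<in> J) - of_bool (k - 1 \<in> J)"
proof -
  have J: "finite J" using assms(1) finite_subset by blast
  have "(\<Sum>i\<in>J. simple_root r i) k = (\<Sum>i\<in>J. of_bool (k = i) - of_bool (k = Suc i))"
    unfolding sum_fun_apply using assms by (intro sum.cong refl simple_root_apply) auto
  also have "\<dots> = (\<Sum>i\<in>J. of_bool (k = i)) - (\<Sum>i\<in>J. of_bool (k - 1 = i))"
    unfolding sum_subtractf[symmetric] using assms by (intro sum.cong refl) auto
  also have "\<dots> = of_bool (k \<in> J) - of_bool (k - 1 \<in> J)"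
    using J by (simp add: of_bool_def sum.delta)
  finally show ?thesis .
qed

lemma simple_root_in_Rvec:
  assumes "i \<in> {1..r}"
  shows "simple_root r i \<in> Rvec r"
  using assms by (auto simp: simple_root_def eps_def Rvec_def)

lemma Rvec_diff: "u \<in> Rvec r \<Longrightarrow> v \<in> Rvec r \<Longrightarrow> u - v \<in> Rvec r"
  by (auto simp: Rvec_def)

lemma Rvec_scale: "v \<in> Rvec r \<Longrightarrow> scale c v \<in> Rvec r"
  by (auto simp: Rvec_def scale_def)

lemma Rvec_sum: "(\<And>i. i \<in> J \<Longrightarrow> f i \<in> Rvec r) \<Longrightarrow> (\<Sum>i\<in>J. f i) \<in> Rvec r"
  by (auto simp: Rvec_def sum_fun_apply)

lemma Rvec_eqI:
  assumes "u \<in> Rvec r" "v \<in> Rvec r" "\<And>k. k \<in> {1..r} \<Longrightarrow> u k = v k"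
  shows "u = v"
proof
  fix k show "u k = v k"
    using assms by (cases "k \<in> {1..r}") (auto simp: Rvec_def)
qed

lemma sum_all_simple_roots:
  assumes "r \<ge> 1"
  shows "(\<Sum>i = 1..r. simple_root r i) = eps 1"
proof (rule Rvec_eqI)
  show "(\<Sum>i = 1..r. simple_root r i) \<in> Rvec r"
    by (intro Rvec_sum simple_root_in_Rvec)
  show "eps 1 \<in> Rvec r" using assms by (auto simp: eps_def Rvec_def)
  fix k assume k: "k \<in> {1..r}"
  show "(\<Sum>i = 1..r. simple_root r i) k = eps 1 k"
    unfolding sum_simple_roots_apply[OF subset_refl k] using k by (auto simp: eps_def)
qed

lemma dotprod_eps: "i \<in> {1..r} \<Longrightarrow> dotprod r v (eps i) = v i"
  by (simp add: dotprod_def eps_def if_distrib[where f = "\<lambda>x. _ * x"] cong: if_cong)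

lemma dotprod_diff_right: "dotprod r v (u - w) = dotprod r v u - dotprod r v w"
  by (simp add: dotprod_def right_diff_distrib sum_subtractf)

lemma coroot_pairing_simple_root:
  assumes "i \<in> {1..r}"
  shows "coroot_pairing r (simple_root r i) v = (if i < r then v i - v (Suc i) else 2 * v r)"
proof -
  have "dotprod r u (simple_root r i) = (if i < r then u i - u (Suc i) else u r)" for u
    using assms by (auto simp: simple_root_def dotprod_diff_right dotprod_eps)
  moreover have "simple_root r i i = 1"
    using assms by (auto simp: simple_root_apply)
  moreover have "simple_root r i (Suc i) = -1" if "i < r"
    using assms that by (auto simp: simple_root_apply)
  moreover have "i = r" if "\<not> i < r" using assms that by auto
  ultimately show ?thesis by (auto simp: coroot_pairing_def)
qed

lemma positive_rootsI:
  assumes "1 \<le> i"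
  shows "i < j \<Longrightarrow> j \<le> r \<Longrightarrow> eps i - eps j \<in> positive_roots r"
    and "i < j \<Longrightarrow> j \<le> r \<Longrightarrow> eps i + eps j \<in> positive_roots r"
    and "i \<le> r \<Longrightarrow> eps i \<in> positive_roots r"
  using assms unfolding positive_roots_def by blast+

lemma positive_roots_Suc:
  "positive_roots (Suc r) = positive_roots r \<union>
     ((\<lambda>i. eps i - eps (Suc r)) ` {1..r} \<union> ((\<lambda>i. eps i + eps (Suc r)) ` {1..r} \<union> {eps (Suc r)}))"
  (is "?L = ?R")
proof (intro subset_antisym subsetI)
  fix x assume "x \<in> ?L"
  then consider i j where "x = eps i - eps j" "1 \<le> i" "i < j" "j \<le> Suc r"
    | i j where "x = eps i + eps j" "1 \<le> i" "i < j" "j \<le> Suc r"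
    | i where "x = eps i" "1 \<le> i" "i \<le> Suc r"
    unfolding positive_roots_def by blast
  then show "x \<in> ?R"
  proof cases
    case 1
    then have "j = Suc r \<and> i \<in> {1..r} \<or> x \<in> positive_roots r"
      using positive_rootsI(1)[of i j r] by (cases "j = Suc r") auto
    then show ?thesis using 1 by blast
  next
    case 2
    then have "j = Suc r \<and> i \<in> {1..r} \<or> x \<in> positive_roots r"
      using positive_rootsI(2)[of i j r] by (cases "j = Suc r") auto
    then show ?thesis using 2 by blast
  next
    case 3
    then have "i = Suc r \<or> x \<in> positive_roots r"
      using positive_rootsI(3)[of i r] by (cases "i = Suc r") auto
    then show ?thesis using 3 by blast
  qed
next
  have "x \<in> ?L" if "x \<in> positive_roots r" for x
  proof -
    have "j \<le> Suc r" if "j \<le> r" for j :: nat using that by simp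
    then show ?thesis using that unfolding positive_roots_def by blast
  qed
  moreover have "(\<lambda>i. eps i - eps (Suc r)) ` {1..r} \<subseteq> ?L" "(\<lambda>i. eps i + eps (Suc r)) ` {1..r} \<subseteq> ?L"
    "eps (Suc r) \<in> ?L"
    by (auto intro!: positive_rootsI)
  moreover fix x assume "x \<in> ?R"
  ultimately show "x \<in> ?L" by blast
qed

text \<open>
  Induction on the rank: the roots of rank \<open>r + 1\<close> that are new contribute
  \<open>2 (\<epsilon>\<^sub>1 + \<dots> + \<epsilon>\<^sub>r) + \<epsilon>\<^bsub>r+1\<^esub>\<close> to the sum. Their last coordinate is nonzero, which
  distinguishes them from the old ones.
\<close>

lemma sum_positive_roots_apply:
  "k \<in> {1..r} \<Longrightarrow> (\<Sum>\<alpha>\<in>positive_roots r. \<alpha> k) = 2 * (real r - real k) + 1"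
proof (induction r)
  case 0
  then show ?case by simp
next
  case (Suc r)
  define N1 where "N1 = (\<lambda>i. eps i - eps (Suc r)) ` {1..r}"
  define N2 where "N2 = (\<lambda>i. eps i + eps (Suc r)) ` {1..r}"
  have last_old: "\<alpha> k = 0" if "\<alpha> \<in> positive_roots r" "k > r" for \<alpha> k
    using that by (auto simp: positive_roots_def eps_def)
  have last1: "\<alpha> (Suc r) = -1" if "\<alpha> \<in> N1" for \<alpha>
    using that by (auto simp: N1_def eps_def)
  have last2: "\<alpha> (Suc r) = 1" if "\<alpha> \<in> N2" for \<alpha>
    using that by (auto simp: N2_def eps_def)
  have "eps i \<noteq> 0" for i
    by (auto simp: eps_def fun_eq_iff)
  then have "eps (Suc r) \<notin> N2" by (auto simp: N2_def)
  then have disj2: "N2 \<inter> {eps (Suc r)} = {}" by auto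
  have disj1: "N1 \<inter> (N2 \<union> {eps (Suc r)}) = {}"
    using last1 last2 by (force simp: eps_def)
  have disj0: "positive_roots r \<inter> (N1 \<union> (N2 \<union> {eps (Suc r)})) = {}"
    using last1 last2 last_old by (force simp: eps_def)
  have eps_inj: "i = j" if "eps i = eps j" for i j
    using fun_cong[OF that, of i] by (simp add: eps_def split: if_splits)
  have fin: "finite N1" "finite N2" by (auto simp: N1_def N2_def)
  have s1: "(\<Sum>\<alpha>\<in>N1. \<alpha> k) = (\<Sum>i = 1..r. eps i k - eps (Suc r) k)"
    unfolding N1_def using eps_inj by (subst sum.reindex) (auto intro!: inj_onI)
  have s2: "(\<Sum>\<alpha>\<in>N2. \<alpha> k) = (\<Sum>i = 1..r. eps i k + eps (Suc r) k)"
    unfolding N2_def using eps_inj by (subst sum.reindex) (auto intro!: inj_onI)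
  have new: "(\<Sum>\<alpha>\<in>N1. \<alpha> k) + (\<Sum>\<alpha>\<in>N2. \<alpha> k) = 2 * of_bool (k \<le> r)"
    unfolding s1 s2 sum.distrib sum_subtractf
    using Suc.prems by (simp add: eps_def sum.delta)
  have old: "(\<Sum>\<alpha>\<in>positive_roots r. \<alpha> k) = of_bool (k \<le> r) * (2 * (real r - real k) + 1)"
  proof (cases "k \<le> r")
    case False
    then have "(\<Sum>\<alpha>\<in>positive_roots r. \<alpha> k) = 0"
      using last_old by (intro sum.neutral) auto
    then show ?thesis using False by simp
  qed (use Suc in auto)
  have "(\<Sum>\<alpha>\<in>positive_roots (Suc r). \<alpha> k) =
      (\<Sum>\<alpha>\<in>positive_roots r. \<alpha> k) + ((\<Sum>\<alpha>\<in>N1. \<alpha> k) + ((\<Sum>\<alpha>\<in>N2. \<alpha> k) + eps (Suc r) k))"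
    unfolding positive_roots_Suc N1_def[symmetric] N2_def[symmetric]
    using disj0 disj1 disj2 fin finite_positive_roots by (simp add: sum.union_disjoint)
  also have "\<dots> = of_bool (k \<le> r) * (2 * (real r - real k) + 1) + 2 * of_bool (k \<le> r)
      + eps (Suc r) k"
    using old new by simp
  also have "\<dots> = 2 * (real (Suc r) - real k) + 1"
    using Suc.prems by (auto simp: eps_def)
  finally show ?case .
qed

lemma rho_apply: "k \<in> {1..r} \<Longrightarrow> rho r k = real r - real k + 1 / 2"
  using sum_positive_roots_apply[of k r] by (simp add: rho_def scale_def sum_fun_apply)

lemma rho_in_Rvec: "rho r \<in> Rvec r"
  unfolding rho_def
  by (intro Rvec_scale Rvec_sum) (auto simp: positive_roots_def Rvec_def eps_def)

definition eps1_plus_rho :: "nat \<Rightarrow> weight_vec" where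
  "eps1_plus_rho r = eps 1 + rho r"

lemma eps1_plus_rho_apply:
  "k \<in> {1..r} \<Longrightarrow> eps1_plus_rho r k = real r - real k + 1 / 2 + of_bool (k = 1)"
  by (simp add: eps1_plus_rho_def rho_apply) (simp add: eps_def)

lemma eps1_plus_rho_in_Rvec: "r \<ge> 1 \<Longrightarrow> eps1_plus_rho r \<in> Rvec r"
  using rho_in_Rvec[of r] by (auto simp: eps1_plus_rho_def Rvec_def eps_def)

lemma eps1_plus_rho_pos: "k \<in> {1..r} \<Longrightarrow> eps1_plus_rho r k > 0"
  by (simp add: eps1_plus_rho_apply)

lemma eps1_plus_rho_strict_decreasing:
  "i \<in> {1..r} \<Longrightarrow> j \<in> {1..r} \<Longrightarrow> i < j \<Longrightarrow> eps1_plus_rho r j < eps1_plus_rho r i"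
  by (simp add: eps1_plus_rho_apply)

section \<open>Positivity of the partition function\<close>

text \<open>
  For \<open>n \<le> r\<close> the partial sum up to \<open>n\<close> reads off the coefficient of \<open>\<alpha>\<^sub>n\<close> in the basis of simple roots, so
  for a positive root it is one of \<open>0\<close>, \<open>1\<close>, \<open>2\<close>.
\<close>

lemma positive_root_partial_sum:
  assumes "\<alpha> \<in> positive_roots r"
  shows "(\<Sum>k = 1..n. \<alpha> k) \<in> \<nat>"
proof -
  have e: "(\<Sum>k = 1..n. eps i k) = of_bool (i \<le> n)" if "1 \<le> i" for i
    using that by (simp add: eps_def sum.delta)
  show ?thesis
    using assms e unfolding positive_roots_def
    by (auto simp: sum.distrib sum_subtractf e[simplified])
qed

lemma sum_in_Nats:
  fixes f :: "'a \<Rightarrow> 'b :: semiring_1"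
  shows "(\<And>x. x \<in> A \<Longrightarrow> f x \<in> \<nat>) \<Longrightarrow> sum f A \<in> \<nat>"
  by (induction A rule: infinite_finite_induct) (simp_all add: Nats_add)

lemma kostant_pos_partial_sum:
  assumes "kostant r \<xi> > 0"
  shows "(\<Sum>k = 1..n. \<xi> k) \<in> \<nat>"
proof -
  have "kostant_partitions r \<xi> \<noteq> {}"
    using assms unfolding kostant_def by (metis card.empty less_numeral_extra(3))
  then obtain m where "\<xi> = (\<Sum>\<alpha>\<in>positive_roots r. scale (real (m \<alpha>)) \<alpha>)"
    by (auto simp: kostant_partitions_def)
  then have "(\<Sum>k = 1..n. \<xi> k) = (\<Sum>k = 1..n. \<Sum>\<alpha>\<in>positive_roots r. real (m \<alpha>) * \<alpha> k)"
    by (simp add: sum_fun_apply scale_def)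
  also have "\<dots> = (\<Sum>\<alpha>\<in>positive_roots r. real (m \<alpha>) * (\<Sum>k = 1..n. \<alpha> k))"
    by (subst sum.swap) (simp add: sum_distrib_left)
  also have "\<dots> \<in> \<nat>"
    by (rule sum_in_Nats, rule Nats_mult[OF of_nat_in_Nats], rule positive_root_partial_sum)
  finally show ?thesis .
qed

lemma simple_root_inj: "inj_on (simple_root r) {1..r}"
proof (rule inj_onI)
  fix i j assume ij: "i \<in> {1..r}" "j \<in> {1..r}" "simple_root r i = simple_root r j"
  have "simple_root r j i = simple_root r i i" using ij(3) by simp
  then have "of_bool (i = j) - of_bool (i = Suc j) = (1 :: real)"
    using ij(1,2) by (simp add: simple_root_apply)
  then show "i = j" by (cases "i = j"; cases "i = Suc j") auto
qed

lemma simple_root_positive: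
  assumes "i \<in> {1..r}"
  shows "simple_root r i \<in> positive_roots r"
proof (cases "i < r")
  case True
  then have "simple_root r i = eps i - eps (Suc i)" by (simp add: simple_root_def)
  then show ?thesis using True assms positive_rootsI(1)[of i "Suc i" r] by simp
next
  case False
  then have "simple_root r i = eps r" "1 \<le> r" using assms by (auto simp: simple_root_def)
  then show ?thesis using positive_rootsI(3)[of r r] by simp
qed

lemma kostant_sum_simple_roots_pos:
  assumes J: "J \<subseteq> {1..r}"
  shows "kostant r (\<Sum>i\<in>J. simple_root r i) > 0"
proof -
  define m :: "weight_vec \<Rightarrow> nat" where "m \<alpha> = of_bool (\<alpha> \<in> simple_root r ` J)" for \<alpha>
  have sub: "simple_root r ` J \<subseteq> positive_roots r"
    using J simple_root_positive by blast
  have "(\<Sum>\<alpha>\<in>positive_roots r. scale (real (m \<alpha>)) \<alpha>) = (\<Sum>\<alpha>\<in>simple_root r ` J. \<alpha>)"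
    using sub finite_positive_roots
    by (intro sum.mono_neutral_cong_right) (auto simp: m_def scale_def fun_eq_iff)
  also have "\<dots> = (\<Sum>i\<in>J. simple_root r i)"
    using inj_on_subset[OF simple_root_inj J] by (simp add: sum.reindex)
  finally have "m \<in> kostant_partitions r (\<Sum>i\<in>J. simple_root r i)"
    using sub by (auto simp: kostant_partitions_def m_def)
  then show ?thesis
    using finite_kostant_partitions by (auto simp: kostant_def card_gt_0_iff)
qed

section \<open>The Weyl group acts by signed permutations\<close>

definition signed_permutation :: "nat \<Rightarrow> (nat \<Rightarrow> real) \<Rightarrow> (nat \<Rightarrow> nat) \<Rightarrow>
    (weight_vec \<Rightarrow> weight_vec) \<Rightarrow> bool" where
  "signed_permutation r s p f \<longleftrightarrow> bij_betw p {1..r} {1..r} \<and> (\<forall>k. \<bar>s k\<bar> = 1) \<and>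
     (\<forall>v\<in>Rvec r. f v \<in> Rvec r \<and> (\<forall>k\<in>{1..r}. f v k = s k * v (p k)))"

lemma reflection_apply:
  "v \<in> Rvec r \<Longrightarrow> reflection r \<alpha> v = v - scale (coroot_pairing r \<alpha> v) \<alpha>"
  by (simp add: reflection_def)

lemma signed_permutation_reflection:
  assumes i: "i \<in> {1..r}"
  shows "\<exists>s p. signed_permutation r s p (reflection r (simple_root r i))"
proof (cases "i < r")
  case True
  define p where "p = (\<lambda>k. if k = i then Suc i else if k = Suc i then i else k)"
  have "bij_betw p {1..r} {1..r}"
    by (rule bij_betw_byWitness[where f' = p]) (use True i in \<open>auto simp: p_def\<close>)
  moreover have "reflection r (simple_root r i) v k = 1 * v (p k)"
    if "v \<in> Rvec r" "k \<in> {1..r}" for v k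
    using that True i
    by (simp add: reflection_apply coroot_pairing_simple_root scale_def simple_root_apply p_def)
  moreover have "reflection r (simple_root r i) v \<in> Rvec r" if "v \<in> Rvec r" for v
    using that i by (simp add: reflection_apply Rvec_diff Rvec_scale simple_root_in_Rvec)
  ultimately have "signed_permutation r (\<lambda>_. 1) p (reflection r (simple_root r i))"
    by (simp add: signed_permutation_def)
  then show ?thesis by blast
next
  case False
  then have "i = r" using i by simp
  define s where "s = (\<lambda>k. if k = r then -1 else 1 :: real)"
  have "reflection r (simple_root r i) v k = s k * v (id k)"
    if "v \<in> Rvec r" "k \<in> {1..r}" for v k
    using that i unfolding \<open>i = r\<close>
    by (simp add: reflection_apply coroot_pairing_simple_root scale_def simple_root_apply s_def)
  moreover have "reflection r (simple_root r i) v \<in> Rvec r" if "v \<in> Rvec r" for v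
    using that i by (simp add: reflection_apply Rvec_diff Rvec_scale simple_root_in_Rvec)
  ultimately have "signed_permutation r s id (reflection r (simple_root r i))"
    by (simp add: signed_permutation_def s_def)
  then show ?thesis by blast
qed

lemma signed_permutation_comp:
  assumes f: "signed_permutation r s p f" and g: "signed_permutation r t q g"
  shows "signed_permutation r (\<lambda>k. s k * t (p k)) (q \<circ> p) (compose (Rvec r) f g)"
proof -
  have "p k \<in> {1..r}" if "k \<in> {1..r}" for k
    using f that unfolding signed_permutation_def by (meson bij_betwE)
  moreover have "bij_betw (q \<circ> p) {1..r} {1..r}"
    using f g unfolding signed_permutation_def by (blast intro: bij_betw_trans)
  ultimately show ?thesis
    using f g by (simp add: signed_permutation_def compose_def abs_mult mult.assoc)
qed

lemma signed_permutation_inverse: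
  assumes f: "signed_permutation r s p f"
    and g: "\<And>v. v \<in> Rvec r \<Longrightarrow> g v \<in> Rvec r" "\<And>v. v \<in> Rvec r \<Longrightarrow> f (g v) = v"
  shows "\<exists>t q. signed_permutation r t q g"
proof -
  define q where "q = inv_into {1..r} p"
  have p: "bij_betw p {1..r} {1..r}" and s: "\<And>k. \<bar>s k\<bar> = 1"
    using f by (auto simp: signed_permutation_def)
  have q: "bij_betw q {1..r} {1..r}"
    unfolding q_def using p by (rule bij_betw_inv_into)
  have "g v k = s (q k) * v (q k)" if v: "v \<in> Rvec r" and k: "k \<in> {1..r}" for v k
  proof -
    have "q k \<in> {1..r}" using q k by (meson bij_betwE)
    moreover have "p (q k) = k"
      unfolding q_def using p k by (simp add: bij_betw_inv_into_right)
    ultimately have "v (q k) = s (q k) * g v k"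
      using f g v unfolding signed_permutation_def by metis
    moreover have "s (q k) * s (q k) = 1"
      using s[of "q k"] by (metis abs_mult_self_eq mult_1)
    ultimately show ?thesis by (metis mult.assoc mult_1)
  qed
  then have "signed_permutation r (\<lambda>k. s (q k)) q g"
    using q s g by (simp add: signed_permutation_def)
  then show ?thesis by blast
qed

lemma BijGroup_carrier_apply:
  assumes "f \<in> carrier (BijGroup S)" "x \<in> S"
  shows "f x \<in> S"
  using assms by (auto simp: BijGroup_def Bij_def dest: bij_betw_apply)

lemma weyl_group_carrier: "w \<in> weyl_group r \<Longrightarrow> w \<in> carrier (BijGroup (Rvec r))"
  unfolding weyl_group_def
  using reflection_simple_root_in_BijGroup
  by (intro group.generate_in_carrier[OF group_BijGroup]) auto

lemma weyl_group_signed_permutation: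
  assumes "w \<in> weyl_group r"
  shows "\<exists>s p. signed_permutation r s p w"
  using assms unfolding weyl_group_def
proof (induction w rule: generate.induct)
  case one
  have "signed_permutation r (\<lambda>_. 1) id \<one>\<^bsub>BijGroup (Rvec r)\<^esub>"
    by (simp add: signed_permutation_def BijGroup_def)
  then show ?case by blast
next
  case (incl h)
  then show ?case using signed_permutation_reflection by auto
next
  case (inv h)
  then obtain i where i: "i \<in> {1..r}" "h = reflection r (simple_root r i)" by auto
  then have h: "h \<in> carrier (BijGroup (Rvec r))"
    using reflection_simple_root_in_BijGroup by simp
  let ?g = "inv\<^bsub>BijGroup (Rvec r)\<^esub> h"
  have g: "?g \<in> carrier (BijGroup (Rvec r))"
    using h by (simp add: group.inv_closed[OF group_BijGroup])
  have "h \<otimes>\<^bsub>BijGroup (Rvec r)\<^esub> ?g = \<one>\<^bsub>BijGroup (Rvec r)\<^esub>"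
    using h by (simp add: group.r_inv[OF group_BijGroup])
  then have comp: "compose (Rvec r) h ?g = (\<lambda>v\<in>Rvec r. v)"
    using h g by (simp add: BijGroup_def)
  have "h (?g v) = v" if "v \<in> Rvec r" for v
    using fun_cong[OF comp, of v] that by (simp add: compose_def)
  moreover have "?g v \<in> Rvec r" if "v \<in> Rvec r" for v
    using g that by (rule BijGroup_carrier_apply)
  moreover have "\<exists>s p. signed_permutation r s p h"
    unfolding i(2) by (rule signed_permutation_reflection[OF i(1)])
  then obtain s p where "signed_permutation r s p h" by (elim exE)
  ultimately show ?case by (intro signed_permutation_inverse)
next
  case (eng f g)
  then have W: "f \<in> weyl_group r" "g \<in> weyl_group r" by (simp_all add: weyl_group_def)
  have mult: "f \<otimes>\<^bsub>BijGroup (Rvec r)\<^esub> g = compose (Rvec r) f g"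
    using weyl_group_carrier[OF W(1)] weyl_group_carrier[OF W(2)] by (simp add: BijGroup_def)
  obtain s p t q where "signed_permutation r s p f" "signed_permutation r t q g"
    using eng.IH by (elim exE)
  then show ?case
    unfolding mult by (intro exI) (rule signed_permutation_comp)
qed

text \<open>
  The vector \<open>eps1_plus_rho r\<close> has distinct positive coordinates, so a signed permutation can be
  recovered from its value there: absolute values give the permutation, then signs are visible.
\<close>

lemma weyl_group_eqI:
  assumes r: "r \<ge> 1" and w: "w \<in> weyl_group r" "w' \<in> weyl_group r"
    and eq: "w (eps1_plus_rho r) = w' (eps1_plus_rho r)"
  shows "w = w'"
proof -
  let ?a = "eps1_plus_rho r"
  obtain s p t q where f: "signed_permutation r s p w" "signed_permutation r t q w'"
    using w weyl_group_signed_permutation by meson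
  have ext: "w \<in> extensional (Rvec r)" "w' \<in> extensional (Rvec r)"
    using w weyl_group_carrier by (auto simp: BijGroup_def Bij_def)
  have same: "p k = q k \<and> s k = t k" if k: "k \<in> {1..r}" for k
  proof -
    have pq: "p k \<in> {1..r}" "q k \<in> {1..r}"
      using f k unfolding signed_permutation_def by (meson bij_betwE)+
    have pos: "?a (p k) > 0" "?a (q k) > 0" using pq eps1_plus_rho_pos by auto
    have val: "s k * ?a (p k) = t k * ?a (q k)"
      using f k eq eps1_plus_rho_in_Rvec[OF r] unfolding signed_permutation_def by metis
    then have "\<bar>s k\<bar> * \<bar>?a (p k)\<bar> = \<bar>t k\<bar> * \<bar>?a (q k)\<bar>"
      by (metis abs_mult)
    then have "?a (p k) = ?a (q k)"
      using f pos by (simp add: signed_permutation_def)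
    then have "p k = q k"
      using eps1_plus_rho_strict_decreasing pq by (metis less_irrefl linorder_neqE_nat)
    then show ?thesis using val pos by simp
  qed
  show ?thesis
  proof (rule extensionalityI[OF ext])
    fix v assume v: "v \<in> Rvec r"
    show "w v = w' v"
      by (rule Rvec_eqI[of _ r]) (use f v same in \<open>auto simp: signed_permutation_def\<close>)
  qed
qed

lemma sum_le_initial_segment:
  fixes a :: "nat \<Rightarrow> real"
  assumes "S \<subseteq> {1..r}" "card S = n"
    and "\<And>i j. i \<in> {1..r} \<Longrightarrow> j \<in> {1..r} \<Longrightarrow> i \<le> j \<Longrightarrow> a j \<le> a i"
  shows "(\<Sum>k\<in>S. a k) \<le> (\<Sum>k = 1..n. a k)"
  using assms(1,2)
proof (induction n arbitrary: S)
  case 0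
  then have "S = {}" using finite_subset[of S "{1..r}"] by simp
  then show ?case by simp
next
  case (Suc n)
  have fin: "finite S" and ne: "S \<noteq> {}" using Suc.prems finite_subset[of S "{1..r}"] by auto
  define m where "m = Max S"
  have m: "m \<in> S" using fin ne by (simp add: m_def)
  have "S \<subseteq> {1..m}" using fin Suc.prems by (auto simp: m_def)
  then have "Suc n \<le> m" using Suc.prems(2) card_mono[of "{1..m}" S] by simp
  then have "a m \<le> a (Suc n)" using m Suc.prems(1) by (intro assms(3)) auto
  moreover have "(\<Sum>k\<in>S - {m}. a k) \<le> (\<Sum>k = 1..n. a k)"
    using Suc.prems m fin by (intro Suc.IH) auto
  ultimately show ?case using fin m by (simp add: sum.remove)
qed

text \<open>
  A dominant vector dominates its orbit: discarding signs and choosing the \<open>n\<close> largest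
  coordinates both increase the partial sum.
\<close>

lemma sum_signed_permutation_le:
  assumes f: "signed_permutation r s p f" and v: "v \<in> Rvec r" and n: "n \<le> r"
    and pos: "\<And>k. k \<in> {1..r} \<Longrightarrow> v k \<ge> 0"
    and dec: "\<And>i j. i \<in> {1..r} \<Longrightarrow> j \<in> {1..r} \<Longrightarrow> i \<le> j \<Longrightarrow> v j \<le> v i"
  shows "(\<Sum>k = 1..n. f v k) \<le> (\<Sum>k = 1..n. v k)"
proof -
  have p: "bij_betw p {1..r} {1..r}" using f by (simp add: signed_permutation_def)
  have inj: "inj_on p {1..n}"
    using p n by (auto simp: bij_betw_def intro: inj_on_subset)
  have im: "p ` {1..n} \<subseteq> {1..r}"
    using p n by (auto simp: bij_betw_def)
  have "(\<Sum>k = 1..n. f v k) \<le> (\<Sum>k = 1..n. v (p k))"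
  proof (rule sum_mono)
    fix k assume k: "k \<in> {1..n}"
    then have "f v k = s k * v (p k)" "\<bar>s k\<bar> = 1"
      using f v n by (auto simp: signed_permutation_def)
    moreover have "v (p k) \<ge> 0" using im k pos by blast
    ultimately show "f v k \<le> v (p k)"
      by (metis abs_le_D1 abs_mult abs_of_nonneg mult_1 order_refl)
  qed
  also have "\<dots> = (\<Sum>k\<in>p ` {1..n}. v k)"
    using inj by (simp add: sum.reindex)
  also have "\<dots> \<le> (\<Sum>k = 1..n. v k)"
    using im inj dec by (intro sum_le_initial_segment) (auto simp: card_image)
  finally show ?thesis .
qed

lemma signed_permutation_isometry:
  assumes f: "signed_permutation r s p f" and v: "v \<in> Rvec r"
  shows "(\<Sum>k = 1..r. (f v k)\<^sup>2) = (\<Sum>k = 1..r. (v k)\<^sup>2)"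
proof -
  have "(f v k)\<^sup>2 = (v (p k))\<^sup>2" if "k \<in> {1..r}" for k
  proof -
    have "f v k = s k * v (p k)" "\<bar>s k\<bar> = 1"
      using f v that by (auto simp: signed_permutation_def)
    then show ?thesis by (metis abs_mult mult_1 power2_abs)
  qed
  then have "(\<Sum>k = 1..r. (f v k)\<^sup>2) = (\<Sum>k = 1..r. (v (p k))\<^sup>2)" by simp
  also have "\<dots> = (\<Sum>k = 1..r. (v k)\<^sup>2)"
    using f sum.reindex_bij_betw[of p "{1..r}" "{1..r}" "\<lambda>k. (v k)\<^sup>2"]
    by (simp add: signed_permutation_def)
  finally show ?thesis .
qed

section \<open>The alternation set and sparse sets\<close>

text \<open>
  Here \<open>c k - c (k - 1)\<close> is the \<open>k\<close>-th coordinate of \<open>\<Sum> c\<^sub>i \<alpha>\<^sub>i\<close>. Because \<open>c k\<^sup>2 = c k\<close>, the terms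
  of the difference \<open>(a,a) - (a - \<Sum> c\<^sub>i \<alpha>\<^sub>i, a - \<Sum> c\<^sub>i \<alpha>\<^sub>i)\<close> that are linear in \<open>c\<close> telescope; the
  boundary term \<open>2 * (x - n) * c n\<close> keeps the induction going and vanishes for \<open>n = x\<close>, the rank.
\<close>

lemma norm_defect:
  fixes c a :: "nat \<Rightarrow> real" and x :: real
  assumes c: "\<And>k. c k * c k = c k" and c0: "c 0 = 0"
    and a: "\<And>k. k \<in> {1..n} \<Longrightarrow> a k = x - real k + 1 / 2 + of_bool (k = 1)"
  shows "(\<Sum>k = 1..n. (a k)\<^sup>2 - (a k - (c k - c (k - 1)))\<^sup>2) =
    2 * of_bool (n \<ge> 1) * c 1 + 2 * (\<Sum>k = 1..n. c k * c (k - 1)) + 2 * (x - real n) * c n"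
  using a
proof (induction n)
  case 0
  then show ?case by (simp add: c0)
next
  case (Suc n)
  have "(a (Suc n))\<^sup>2 - (a (Suc n) - (c (Suc n) - c n))\<^sup>2 =
      2 * a (Suc n) * (c (Suc n) - c n) - (c (Suc n) * c (Suc n) + c n * c n)
        + 2 * (c (Suc n) * c n)"
    by (simp add: power2_eq_square algebra_simps)
  also have "\<dots> = 2 * (x - real (Suc n) + 1 / 2 + of_bool (n = 0)) * (c (Suc n) - c n)
      - c (Suc n) - c n + 2 * (c (Suc n) * c n)"
    by (simp only: c) (simp add: Suc.prems)
  finally have step: "(a (Suc n))\<^sup>2 - (a (Suc n) - (c (Suc n) - c n))\<^sup>2 = \<dots>" .
  have IH: "(\<Sum>k = 1..n. (a k)\<^sup>2 - (a k - (c k - c (k - 1)))\<^sup>2) =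
    2 * of_bool (n \<ge> 1) * c 1 + 2 * (\<Sum>k = 1..n. c k * c (k - 1)) + 2 * (x - real n) * c n"
    using Suc by simp
  have "(\<Sum>k = 1..Suc n. (a k)\<^sup>2 - (a k - (c k - c (k - 1)))\<^sup>2) =
      (\<Sum>k = 1..n. (a k)\<^sup>2 - (a k - (c k - c (k - 1)))\<^sup>2)
        + ((a (Suc n))\<^sup>2 - (a (Suc n) - (c (Suc n) - c n))\<^sup>2)"
    by simp
  then show ?case unfolding IH step
    by (cases "n = 0") (simp_all add: c0 algebra_simps)
qed

text \<open>
  The coefficients \<open>c n\<close> of \<open>a - w a\<close> in the simple roots are its partial sums. Positivity of the
  partition function bounds them above, dominance of \<open>a\<close> below, and the equality of lengths then
  forces \<open>c 1 = 0\<close> and \<open>c k * c (k - 1) = 0\<close>.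
\<close>

lemma alternation_set_imp_sparse:
  assumes r: "r \<ge> 1" and w: "w \<in> weyl_alternation_set r (eps 1) 0"
  shows "\<exists>J\<in>sparse_sets r. w (eps1_plus_rho r) = eps1_plus_rho r - (\<Sum>i\<in>J. simple_root r i)"
proof -
  define a where "a = eps1_plus_rho r"
  have wW: "w \<in> weyl_group r" and kos: "kostant r (w a - rho r) > 0"
    using w by (auto simp: weyl_alternation_set_def a_def eps1_plus_rho_def)
  obtain s p where sp: "signed_permutation r s p w"
    using wW weyl_group_signed_permutation by blast
  have aR: "a \<in> Rvec r" using eps1_plus_rho_in_Rvec[OF r] by (simp add: a_def)
  have waR: "w a \<in> Rvec r" using sp aR by (simp add: signed_permutation_def)
  \<comment> \<open>Truncation beyond \<open>r\<close> makes \<open>c\<close> idempotent everywhere.\<close>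
  define c where "c n = (if n \<le> r then (\<Sum>k = 1..n. a k - w a k) else 0)" for n
  have c01: "c n = 0 \<or> c n = 1" for n
  proof (cases "n \<in> {1..r}")
    case True
    have "(\<Sum>k = 1..n. a k - rho r k) = (\<Sum>k = 1..n. eps 1 k)"
      by (simp add: a_def eps1_plus_rho_def)
    also have "\<dots> = 1" using True by (simp add: eps_def sum.delta)
    finally have "(\<Sum>k = 1..n. (w a - rho r) k) = 1 - c n"
      using True by (simp add: c_def sum_subtractf)
    then have "1 - c n \<in> \<nat>"
      using kostant_pos_partial_sum[OF kos, of n] by simp
    moreover have "c n \<ge> 0"
    proof -
      have dec: "a j \<le> a i" if "i \<in> {1..r}" "j \<in> {1..r}" "i \<le> j" for i j
        using that eps1_plus_rho_strict_decreasing[of i r j]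
        by (cases "i = j") (auto simp: a_def)
      have "a k \<ge> 0" if "k \<in> {1..r}" for k
        using eps1_plus_rho_pos[OF that] by (simp add: a_def)
      then have "(\<Sum>k = 1..n. w a k) \<le> (\<Sum>k = 1..n. a k)"
        using True dec by (intro sum_signed_permutation_le[OF sp aR]) auto
      then show ?thesis using True by (simp add: c_def sum_subtractf)
    qed
    moreover obtain m where m: "1 - c n = real m"
      using \<open>1 - c n \<in> \<nat>\<close> by (rule Nats_cases)
    ultimately have "m = 0 \<or> m = 1" by linarith
    then show ?thesis using m by auto
  next
    case False
    then show ?thesis by (auto simp: c_def)
  qed
  have c0: "c 0 = 0" by (simp add: c_def)
  have diff: "a k - w a k = c k - c (k - 1)" if "k \<in> {1..r}" for k
    using that by (cases k) (auto simp: c_def)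
  have defect: "2 * c 1 + 2 * (\<Sum>k = 1..r. c k * c (k - 1)) = 0"
  proof -
    have "(\<Sum>k = 1..r. (a k)\<^sup>2 - (a k - (c k - c (k - 1)))\<^sup>2) = (\<Sum>k = 1..r. (a k)\<^sup>2 - (w a k)\<^sup>2)"
      by (rule sum.cong[OF refl]) (simp only: diff[symmetric], simp)
    also have "\<dots> = 0"
      using signed_permutation_isometry[OF sp aR] by (simp add: sum_subtractf)
    finally have "(\<Sum>k = 1..r. (a k)\<^sup>2 - (a k - (c k - c (k - 1)))\<^sup>2) = 0" .
    moreover have "c k * c k = c k" for k using c01[of k] by auto
    moreover have "a k = real r - real k + 1 / 2 + of_bool (k = 1)" if "k \<in> {1..r}" for k
      using eps1_plus_rho_apply[OF that] by (simp add: a_def)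
    ultimately show ?thesis
      using r norm_defect[of c r a "real r"] c0 by simp
  qed
  have nn: "c k * c (k - 1) \<ge> 0" "c k \<ge> 0" for k
    using c01[of k] c01[of "k - 1"] by auto
  have "(\<Sum>k = 1..r. c k * c (k - 1)) \<ge> 0" by (intro sum_nonneg nn)
  with defect nn(2)[of 1] have c1: "c 1 = 0" and "(\<Sum>k = 1..r. c k * c (k - 1)) = 0"
    by linarith+
  then have adj: "c k * c (k - 1) = 0" if "k \<in> {1..r}" for k
    using that nn(1) by (simp add: sum_nonneg_eq_0_iff)
  define J where "J = {k \<in> {1..r}. c k = 1}"
  have cJ: "c k = of_bool (k \<in> J)" if "k \<le> r" for k
    using c01[of k] c0 that by (cases "k = 0") (auto simp: J_def)
  have "J \<in> sparse_sets r"
  proof -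
    have "k \<ge> 2" if "k \<in> J" for k
      using that c1 by (cases "k = 1") (auto simp: J_def)
    moreover have "Suc k \<notin> J" if "k \<in> J" for k
      using that adj[of "Suc k"] by (auto simp: J_def)
    ultimately show ?thesis by (auto simp: sparse_sets_def J_def)
  qed
  moreover have "w a = a - (\<Sum>i\<in>J. simple_root r i)"
  proof (rule Rvec_eqI[OF waR])
    show "a - (\<Sum>i\<in>J. simple_root r i) \<in> Rvec r"
      by (intro Rvec_diff Rvec_sum simple_root_in_Rvec aR) (auto simp: J_def)
    fix k assume k: "k \<in> {1..r}"
    have "(\<Sum>i\<in>J. simple_root r i) k = of_bool (k \<in> J) - of_bool (k - 1 \<in> J)"
      using k by (intro sum_simple_roots_apply) (auto simp: J_def)
    also have "\<dots> = c k - c (k - 1)"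
    proof -
      have "k \<le> r" "k - 1 \<le> r" using k by auto
      then show ?thesis by (simp only: cJ)
    qed
    finally show "w a k = (a - (\<Sum>i\<in>J. simple_root r i)) k"
      using diff[OF k] by simp
  qed
  ultimately show ?thesis by (auto simp: a_def)
qed

text \<open>
  Apply the reflections \<open>s\<^sub>n\<close>, \<open>n \<in> J\<close>, one after another. Each pairing
  \<open>\<langle>a - \<Sum>\<^bsub>i\<in>J\<^esub> \<alpha>\<^sub>i, \<alpha>\<^sub>n\<^sup>\<or>\<rangle>\<close> equals \<open>\<langle>a, \<alpha>\<^sub>n\<^sup>\<or>\<rangle> = 1\<close>, since \<open>n \<ge> 2\<close> and \<open>\<alpha>\<^sub>n\<close> is orthogonal to the
  other \<open>\<alpha>\<^sub>i\<close>.
\<close>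

lemma sparse_set_realised:
  assumes r: "r \<ge> 1" and J: "J \<in> sparse_sets r"
  shows "\<exists>w\<in>weyl_group r. w (eps1_plus_rho r) = eps1_plus_rho r - (\<Sum>i\<in>J. simple_root r i)"
proof -
  define a where "a = eps1_plus_rho r"
  have aR: "a \<in> Rvec r" using eps1_plus_rho_in_Rvec[OF r] by (simp add: a_def)
  have "finite J" using J finite_subset by (auto simp: sparse_sets_def)
  then have "\<exists>w\<in>weyl_group r. w a = a - (\<Sum>i\<in>J. simple_root r i)" using J
  proof (induction J rule: finite_induct)
    case empty
    have "\<one>\<^bsub>BijGroup (Rvec r)\<^esub> \<in> weyl_group r"
      unfolding weyl_group_def by (rule generate.one)
    moreover have "\<one>\<^bsub>BijGroup (Rvec r)\<^esub> a = a"
      using aR by (simp add: BijGroup_def)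
    ultimately show ?case by force
  next
    case (insert n J)
    have nJ: "n \<in> {2..r}" "n - 1 \<notin> J" "Suc n \<notin> J" "J \<subseteq> {1..r}" "J \<in> sparse_sets r"
    proof -
      show n: "n \<in> {2..r}" and "Suc n \<notin> J" "J \<subseteq> {1..r}" "J \<in> sparse_sets r"
        using insert.prems by (auto simp: sparse_sets_def)
      have "Suc (n - 1) = n" using n by simp
      moreover have "Suc k \<noteq> n" if "k \<in> J" for k
        using insert.prems that by (auto simp: sparse_sets_def)
      ultimately show "n - 1 \<notin> J" by blast
    qed
    then obtain w where w: "w \<in> weyl_group r" "w a = a - (\<Sum>i\<in>J. simple_root r i)"
      using insert.IH by blast
    define u where "u = a - (\<Sum>i\<in>J. simple_root r i)"
    have uR: "u \<in> Rvec r"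
      unfolding u_def using nJ by (intro Rvec_diff Rvec_sum simple_root_in_Rvec aR) auto
    let ?s = "reflection r (simple_root r n)"
    have n: "n \<in> {1..r}" using nJ by auto
    have u_apply: "u k = real r - real k + 1 / 2 + of_bool (k = 1)
        - (of_bool (k \<in> J) - of_bool (k - 1 \<in> J))" if "k \<in> {1..r}" for k
      using that nJ sum_simple_roots_apply[of J r k] eps1_plus_rho_apply[of k r]
      by (simp add: u_def a_def)
    have "coroot_pairing r (simple_root r n) u = 1"
      using n nJ insert.hyps u_apply[of n] u_apply[of "Suc n"]
      by (auto simp: coroot_pairing_simple_root)
    then have su: "?s u = a - (\<Sum>i\<in>insert n J. simple_root r i)"
      using uR insert.hyps by (simp add: reflection_apply scale_def u_def fun_eq_iff)
    have s: "?s \<in> weyl_group r"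
      unfolding weyl_group_def using n by (intro generate.incl) auto
    have "?s \<otimes>\<^bsub>BijGroup (Rvec r)\<^esub> w \<in> weyl_group r"
      using s w(1) unfolding weyl_group_def by (rule generate.eng)
    moreover have "(?s \<otimes>\<^bsub>BijGroup (Rvec r)\<^esub> w) a = ?s u"
      using weyl_group_carrier[OF s] weyl_group_carrier[OF w(1)] aR w(2)
      by (simp add: BijGroup_def compose_def u_def)
    ultimately show ?case using su by metis
  qed
  then show ?thesis by (simp add: a_def)
qed

text \<open>
  The point of the orbit that belongs to \<open>J\<close> exceeds \<open>\<rho>\<close> by the sum of the simple roots outside
  \<open>J\<close>, which is visibly a combination of positive roots.
\<close>

lemma orbit_points_of_alternation_set:
  assumes r: "r \<ge> 1"
  shows "(\<lambda>w. w (eps1_plus_rho r)) ` weyl_alternation_set r (eps 1) 0 =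
    (\<lambda>J. eps1_plus_rho r - (\<Sum>i\<in>J. simple_root r i)) ` sparse_sets r"
proof (intro subset_antisym subsetI)
  fix x assume "x \<in> (\<lambda>w. w (eps1_plus_rho r)) ` weyl_alternation_set r (eps 1) 0"
  then show "x \<in> (\<lambda>J. eps1_plus_rho r - (\<Sum>i\<in>J. simple_root r i)) ` sparse_sets r"
    using alternation_set_imp_sparse[OF r] by auto
next
  fix x assume "x \<in> (\<lambda>J. eps1_plus_rho r - (\<Sum>i\<in>J. simple_root r i)) ` sparse_sets r"
  then obtain J where J: "J \<in> sparse_sets r"
    and x: "x = eps1_plus_rho r - (\<Sum>i\<in>J. simple_root r i)" by auto
  obtain w where w: "w \<in> weyl_group r" "w (eps1_plus_rho r) = x"
    using sparse_set_realised[OF r J] x by auto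
  have "J \<subseteq> {1..r}" using J by (auto simp: sparse_sets_def)
  then have "eps 1 = (\<Sum>i\<in>J. simple_root r i) + (\<Sum>i\<in>{1..r} - J. simple_root r i)"
    using sum_all_simple_roots[OF r] sum.subset_diff[of J "{1..r}" "simple_root r"]
    by (simp add: add.commute)
  then have "x - rho r = (\<Sum>i\<in>{1..r} - J. simple_root r i)"
    by (simp add: x eps1_plus_rho_def)
  then have "kostant r (x - rho r) > 0"
    using kostant_sum_simple_roots_pos[of "{1..r} - J" r] by simp
  then have "w \<in> weyl_alternation_set r (eps 1) 0"
    using w by (simp add: weyl_alternation_set_def eps1_plus_rho_def)
  then show "x \<in> (\<lambda>w. w (eps1_plus_rho r)) ` weyl_alternation_set r (eps 1) 0"
    using w by auto
qed

lemma sum_simple_roots_inj_on_sparse_sets: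
  "inj_on (\<lambda>J. v - (\<Sum>i\<in>J. simple_root r i)) (sparse_sets r)"
proof (rule inj_onI)
  fix J K assume J: "J \<in> sparse_sets r" and K: "K \<in> sparse_sets r"
    and "v - (\<Sum>i\<in>J. simple_root r i) = v - (\<Sum>i\<in>K. simple_root r i)"
  then have eq: "(\<Sum>i\<in>J. simple_root r i) = (\<Sum>i\<in>K. simple_root r i)" by simp
  have sub: "J \<subseteq> {1..r}" "K \<subseteq> {1..r}" using J K by (auto simp: sparse_sets_def)
  \<comment> \<open>Coordinate \<open>k\<close> relates membership of \<open>k\<close> to membership of \<open>k - 1\<close>.\<close>
  have "k \<le> r \<Longrightarrow> k \<in> J \<longleftrightarrow> k \<in> K" for k
  proof (induction k)
    case 0
    then show ?case using sub by auto
  next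
    case (Suc k)
    then have "of_bool (Suc k \<in> J) - of_bool (k \<in> J) = (of_bool (Suc k \<in> K) - of_bool (k \<in> K) :: real)"
      using sub sum_simple_roots_apply[of J r "Suc k"] sum_simple_roots_apply[of K r "Suc k"] eq
      by simp
    then show ?case using Suc by (auto split: if_splits simp: of_bool_def)
  qed
  then show "J = K" using sub by (meson atLeastAtMost_iff subset_antisym subset_iff)
qed

lemma fundamental_weight_eps_1:
  assumes "r \<ge> 2"
  shows "fundamental_weight r (eps 1)"
  unfolding fundamental_weight_def
proof (intro conjI bexI[of _ 1] ballI)
  show "eps 1 \<in> Rvec r" using assms by (auto simp: eps_def Rvec_def)
  fix j assume "j \<in> {1..r}"
  then show "coroot_pairing r (simple_root r j) (eps 1) = (if j = 1 then 1 else 0)"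
    using assms by (auto simp: coroot_pairing_simple_root eps_def)
qed (use assms in auto)

theorem corollary2p1:
  fixes r :: nat and lam :: weight_vec
  assumes "r \<ge> 2"
    and "lam = (\<Sum>i = 1..r. simple_root r i)"
  shows "fundamental_weight r lam \<and> card (weyl_alternation_set r lam 0) = fib (r + 1)"
proof -
  let ?A = "weyl_alternation_set r (eps 1) 0"
  have r: "r \<ge> 1" using assms(1) by simp
  have lam: "lam = eps 1" using assms(2) sum_all_simple_roots[OF r] by simp
  have "inj_on (\<lambda>w. w (eps1_plus_rho r)) ?A"
    using weyl_group_eqI[OF r] by (intro inj_onI) (auto simp: weyl_alternation_set_def)
  then have "card ?A = card ((\<lambda>w. w (eps1_plus_rho r)) ` ?A)"
    by (simp add: card_image)
  also have "\<dots> = card (sparse_sets r)"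
    unfolding orbit_points_of_alternation_set[OF r]
    by (rule card_image[OF sum_simple_roots_inj_on_sparse_sets])
  also have "\<dots> = fib (r + 1)" by (rule card_sparse_sets)
  finally show ?thesis using fundamental_weight_eps_1[OF assms(1)] lam by simp
qed

end
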